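(* Let $A,B\in\mathrm{SL}(2,\mathbb{R})$. If the set $\{A,B\}$ is dominated, then $C(A,B)$ is well-defined, and either $C(A,B)<1$ or \[ \max\left\{\tfrac{1}{2}\lvert \mathrm{tr}(A)\rvert,\ \tfrac{1}{2}\lvert \mathrm{tr}(B)\rvert\right\}> \frac{5\,C(A,B)-1}{3\,C(A,B)+1}. \]
   Context: $\mathrm{SL}(2,\mathbb{R})$ is equipped with an operator norm $\lVert\cdot\rVert$. A finite set $\{A_1,\dots,A_N\}\subset\mathrm{SL}(2,\mathbb{R})$ is called dominated if there exist constants $C>0$ and $\lambda>1$ such that $\lVert A_{i_n}A_{i_{n-1}}\cdots A_{i_1}\rVert\geq C\lambda^n$ for any sequence $(i_j)\subset\{1,2,\dots,N\}$ and all $n\in\mathbb{N}$. The semigroup generated by a dominated set (in particular, each of its elements) contains only hyperbolic matrices. A non-identity matrix $A\in\mathrm{SL}(2,\mathbb{R})$ is hyperbolic if $\lvert\mathrm{tr}(A)\rvert>2$. A hyperbolic matrix has two eigenvalues $\lvert\lambda_u(A)\rvert>\lvert\lambda_s(A)\rvert$, with distinct corresponding eigenvectors $u(A),s(A)\in\mathbb{R}\mathbb{P}^1$ (respectively). $\mathbb{R}\mathbb{P}^1$ is identified with $\mathbb{R}\cup\{\infty\}$ (the line spanned by $(x,y)^T$ corresponds to $x/y$), so that $\begin{pmatrix}a&b\\c&d\end{pmatrix}$ acts by $x\mapsto\frac{ax+b}{cx+d}$. For hyperbolic $A,B\in\mathrm{SL}(2,\mathbb{R})$ the cross-ratio is \[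 C(A,B)=\frac{u(A)-u(B)}{u(A)-s(B)}\cdot\frac{s(A)-s(B)}{s(A)-u(B)}, \] with the standard conventions at infinity (if one of the points is $\infty$, the differences containing it are omitted; $C(A,B)=0$ if $u(A)=u(B)$ or $s(A)=s(B)$ and the cross-ratio is well-defined). It is well-defined exactly when $u(A)\neq s(B)$ and $u(B)\neq s(A)$. *)

theory Defs
  imports "HOL-Analysis.Analysis"
begin

definition SL2 :: "(real^2^2) set" where
  "SL2 = {A. det A = 1}"

(* The product w (n-1) ** ... ** w 1 ** w 0: later letters multiply on the left. *)
primrec word_prod :: "(nat \<Rightarrow> real^2^2) \<Rightarrow> nat \<Rightarrow> real^2^2" where
  "word_prod w 0 = mat 1"
| "word_prod w (Suc n) = w n ** word_prod w n"

(* The norm is the operator norm induced by the Euclidean norm; any other choice gives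
   the same notion, since all norms on the space of 2x2 matrices are equivalent and C is arbitrary.
   For the same reason it is immaterial whether n = 0 is included. *)
definition dominated :: "(real^2^2) set \<Rightarrow> bool" where
  "dominated S \<longleftrightarrow> finite S \<and> S \<subseteq> SL2 \<and>
     (\<exists>C>0. \<exists>l>1. \<forall>w. range w \<subseteq> S \<longrightarrow> (\<forall>n. onorm ((*v) (word_prod w n)) \<ge> C * l ^ n))"

definition hyperbolic :: "real^2^2 \<Rightarrow> bool" where
  "hyperbolic A \<longleftrightarrow> A \<in> SL2 \<and> A \<noteq> mat 1 \<and> \<bar>trace A\<bar> > 2"

definition eigenvec :: "real^2^2 \<Rightarrow> real \<Rightarrow> real^2 \<Rightarrow> bool" where
  "eigenvec A l v \<longleftrightarrow> v \<noteq> 0 \<and> A *v v = l *\<^sub>R v"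

definition eigenval :: "real^2^2 \<Rightarrow> real \<Rightarrow> bool" where
  "eigenval A l \<longleftrightarrow> (\<exists>v. eigenvec A l v)"

(* lambda_u, lambda_s, and the points eig_u, eig_s below are meaningful for hyperbolic A only. *)
definition lambda_u :: "real^2^2 \<Rightarrow> real" where
  "lambda_u A = (THE l. eigenval A l \<and> (\<exists>m. eigenval A m \<and> \<bar>l\<bar> > \<bar>m\<bar>))"

definition lambda_s :: "real^2^2 \<Rightarrow> real" where
  "lambda_s A = (THE m. eigenval A m \<and> (\<exists>l. eigenval A l \<and> \<bar>l\<bar> > \<bar>m\<bar>))"

(* The real projective line as the reals together with a point at infinity. *)
datatype rp1 = Fin real | Infty

(* The line spanned by a nonzero vector (x,y) corresponds to x/y. *)
definition rp1_of :: "real^2 \<Rightarrow> rp1" where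
  "rp1_of v = (if v $ 2 = 0 then Infty else Fin (v $ 1 / v $ 2))"

definition eig_u :: "real^2^2 \<Rightarrow> rp1" where
  "eig_u A = (THE p. \<exists>v. eigenvec A (lambda_u A) v \<and> p = rp1_of v)"

definition eig_s :: "real^2^2 \<Rightarrow> rp1" where
  "eig_s A = (THE p. \<exists>v. eigenvec A (lambda_s A) v \<and> p = rp1_of v)"

(* A factor p - q of a cross-ratio; the value 1 at infinity means that the factor is omitted. *)
fun rp1_diff :: "rp1 \<Rightarrow> rp1 \<Rightarrow> real" where
  "rp1_diff (Fin x) (Fin y) = x - y"
| "rp1_diff _ _ = 1"

definition cross_ratio_well_defined :: "real^2^2 \<Rightarrow> real^2^2 \<Rightarrow> bool" where
  "cross_ratio_well_defined A B \<longleftrightarrow>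
     hyperbolic A \<and> hyperbolic B \<and> eig_u A \<noteq> eig_s B \<and> eig_u B \<noteq> eig_s A"

(* The case distinction matters only when the two coinciding points are both Infty. *)
definition cross_ratio :: "real^2^2 \<Rightarrow> real^2^2 \<Rightarrow> real" where
  "cross_ratio A B =
     (if eig_u A = eig_u B \<or> eig_s A = eig_s B then 0
      else rp1_diff (eig_u A) (eig_u B) / rp1_diff (eig_u A) (eig_s B) *
           (rp1_diff (eig_s A) (eig_s B) / rp1_diff (eig_s A) (eig_u B)))"

end

theory Submission
  imports Defs
begin

text \<open>
  The products \<open>A\<^sup>m B\<^sup>n\<close> alone decide the matter. Let \<open>a\<close> and \<open>b\<close> be the expanding eigenvalues
  of \<open>A\<close> and \<open>B\<close>, put \<open>x = \<bar>a\<bar>\<^sup>m\<close>, \<open>y = \<bar>b\<bar>\<^sup>n\<close>, and let \<open>t = 1 / (C - 1)\<close>, where \<open>C\<close> is the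
  cross-ratio (\<open>t = 0\<close> standing for an ill-defined one). Up to sign,

    \<open>tr (A\<^sup>m B\<^sup>n) = (1 + t) (x/y + y/x) - t (x y + 1/(x y))\<close>,

  which is \<open>trace_mult_eigenbases\<close> combined with the Pluecker relation between the brackets of the
  four eigenvectors. On the other side, domination makes traces grow exponentially in the word
  length (\<open>dominated_trace_growth\<close>), and no nonempty word can have a trace in \<open>[-2, 2]\<close>
  (\<open>dominated_words_hyperbolic\<close>).

  If the cross-ratio were ill-defined, the trace would be \<open>x/y + y/x\<close>, which stays bounded along
  long words whose exponents are chosen so that \<open>x\<close> and \<open>y\<close> are comparable; this contradicts the
  exponential growth.

  If \<open>C \<ge> 1\<close>, then \<open>t > 0\<close>. Put \<open>\<rho> = sqrt (1 + t) - sqrt t\<close> and pass to the coordinates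
  \<open>p = (x - 1)/(x + 1)\<close>, \<open>q = (y - 1)/(y + 1)\<close>, the hyperbolic tangents of \<open>(ln x)/2\<close> and
  \<open>(ln y)/2\<close>. The condition \<open>\<bar>tr\<bar> \<le> 2\<close> becomes \<open>(p - q)\<^sup>2 \<le> 4 t p q \<le> (1 - p q)\<^sup>2\<close>, and it holds whenever
  \<open>p\<close> and \<open>q\<close> both lie in the window \<open>[\<rho>\<^sup>3, \<rho>]\<close>. The bound \<open>(5 C - 1)/(3 C + 1)\<close> on half the trace of a
  single matrix says that its coordinate is at most \<open>\<rho> / (1 + \<rho>\<^sup>2)\<close>, and this is exactly the step that
  carries \<open>\<rho>\<^sup>3\<close> to \<open>\<rho>\<close> under the addition law of tanh. Powers of \<open>A\<close> and of \<open>B\<close> hence cannot jump over the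
  window (\<open>balanced_powers_give_small_trace\<close>): if both half traces obeyed the bound, some
  \<open>A\<^sup>m B\<^sup>n\<close> would fail to be hyperbolic.
\<close>

section \<open>Trace growth of dominated sets\<close>

text \<open>
  Graded by length, because the growth condition of domination refers to the length of a word and
  the same matrix may be represented by words of several lengths.
\<close>

definition words_of_length :: "(real^2^2) set \<Rightarrow> nat \<Rightarrow> (real^2^2) set" where
  "words_of_length S k = {word_prod w k | w. range w \<subseteq> S}"

abbreviation mat_pow :: "real^2^2 \<Rightarrow> nat \<Rightarrow> real^2^2" where
  "mat_pow M n \<equiv> word_prod (\<lambda>_. M) n"

lemma word_prod_cong: "(\<And>i. i < n \<Longrightarrow> w i = w' i) \<Longrightarrow> word_prod w n = word_prod w' n"
  by (induction n) auto

lemma word_prod_append: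
  "word_prod (\<lambda>i. if i < l then w i else w' (i - l)) (l + k) = word_prod w' k ** word_prod w l"
proof (induction k)
  case 0
  show ?case by (auto intro: word_prod_cong)
next
  case (Suc k)
  then show ?case by (simp add: matrix_mul_assoc)
qed

lemma words_of_length_mult:
  assumes "X \<in> words_of_length S k" "Y \<in> words_of_length S l"
  shows "X ** Y \<in> words_of_length S (l + k)"
proof -
  obtain w w' where w: "range w \<subseteq> S" "Y = word_prod w l" and w': "range w' \<subseteq> S" "X = word_prod w' k"
    using assms by (auto simp: words_of_length_def)
  let ?c = "\<lambda>i. if i < l then w i else w' (i - l)"
  have "range ?c \<subseteq> S"
    using w(1) w'(1) by auto
  moreover have "X ** Y = word_prod ?c (l + k)"
    unfolding w(2) w'(2) by (rule word_prod_append[symmetric])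
  ultimately show ?thesis
    unfolding words_of_length_def by blast
qed

lemma mat_pow_in_words_of_length:
  assumes "M \<in> words_of_length S k"
  shows "mat_pow M j \<in> words_of_length S (k * j)"
proof (induction j)
  case 0
  then show ?case using assms by (auto simp: words_of_length_def)
next
  case (Suc j)
  then show ?case using words_of_length_mult[OF assms Suc] by (simp add: add.commute)
qed

lemma letter_in_words_of_length: "A \<in> S \<Longrightarrow> A \<in> words_of_length S 1"
  unfolding words_of_length_def by (auto intro!: exI[of _ "\<lambda>_. A"])

lemma det_words_of_length:
  assumes "S \<subseteq> SL2" "M \<in> words_of_length S k"
  shows "det M = 1"
proof -
  obtain w where w: "range w \<subseteq> S" "M = word_prod w k"
    using assms(2) by (auto simp: words_of_length_def)
  have "det (w i) = 1" for i
    using w(1) assms(1) by (auto simp: SL2_def)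
  then have "det (word_prod w k) = 1"
    by (induction k) (auto simp: det_mul)
  with w show ?thesis by simp
qed

lemma Cayley_Hamilton_SL2:
  fixes M :: "real^2^2"
  assumes "det M = 1"
  shows "M *v (M *v x) = trace M *\<^sub>R (M *v x) - x"
proof -
  have d: "M$1$1 * M$2$2 = 1 + M$1$2 * M$2$1"
    using assms by (simp add: det_2)
  show ?thesis
    unfolding vec_eq_iff forall_2 using d
    by (simp add: matrix_vector_mult_def sum_2 trace_def algebra_simps)
qed

lemma trace_square_SL2:
  fixes M :: "real^2^2"
  assumes "det M = 1"
  shows "trace (M ** M) = (trace M)\<^sup>2 - 2"
  using assms by (simp add: det_2 trace_def matrix_matrix_mult_def sum_2 power2_eq_square) algebra

text \<open>
  By the Cayley--Hamilton theorem \<open>M\<^sup>j x\<close> satisfies a linear recursion of order two with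
  coefficients \<open>tr M\<close> and \<open>-1\<close>; a sequence bounded by it grows at most like \<open>g\<^sup>j\<close> as soon as
  \<open>g\<^sup>2 \<ge> \<bar>tr M\<bar> g + 1\<close>, and \<open>g = \<bar>tr M\<bar> + 1\<close> is a convenient such value.
\<close>

lemma onorm_mat_pow_le:
  fixes M :: "real^2^2"
  assumes "det M = 1"
  shows "onorm ((*v) (mat_pow M j)) \<le> (1 + onorm ((*v) M)) * (\<bar>trace M\<bar> + 1) ^ j"
proof (rule onorm_le)
  fix x :: "real^2"
  let ?g = "\<bar>trace M\<bar> + 1" and ?K = "1 + onorm ((*v) M)"
  let ?v = "\<lambda>j. mat_pow M j *v x"
  have K: "0 \<le> onorm ((*v) M)"
    by (rule onorm_pos_le) simp
  have step: "?v (Suc j) = M *v ?v j" for j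
    by (simp add: matrix_vector_mul_assoc)
  have "norm (?v j) \<le> ?K * ?g ^ j * norm x \<and> norm (?v (Suc j)) \<le> ?K * ?g ^ Suc j * norm x"
  proof (induction j)
    case 0
    have "norm (M *v x) \<le> onorm ((*v) M) * norm x"
      by (rule onorm) simp
    also have "\<dots> \<le> ?K * ?g * norm x"
      using K by (intro mult_right_mono) (auto simp: algebra_simps)
    finally show ?case using K by (simp add: algebra_simps)
  next
    case (Suc j)
    let ?c = "?K * ?g ^ j * norm x"
    have c: "0 \<le> ?c" using K by simp
    have "norm (?v (Suc (Suc j))) = norm (trace M *\<^sub>R ?v (Suc j) - ?v j)"
      using Cayley_Hamilton_SL2[OF assms, of "?v j"] by (simp only: step)
    also have "\<dots> \<le> \<bar>trace M\<bar> * norm (?v (Suc j)) + norm (?v j)"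
      by (metis norm_scaleR norm_triangle_ineq4 real_norm_def)
    also have "\<dots> \<le> \<bar>trace M\<bar> * (?g * ?c) + ?c"
      using Suc.IH by (intro add_mono mult_left_mono) (auto simp: mult.assoc mult.left_commute)
    also have "\<dots> \<le> ?g * (?g * ?c)"
      using c by (simp add: distrib_right)
    also have "\<dots> = ?K * ?g ^ Suc (Suc j) * norm x" by simp
    finally show ?case using Suc.IH by blast
  qed
  then show "norm (?v j) \<le> ?K * ?g ^ j * norm x" by blast
qed

text \<open>
  The constant \<open>C\<close> of domination disappears when the condition is applied to all powers of \<open>M\<close>
  and compared with the growth allowed by the trace.
\<close>

lemma dominated_trace_growth:
  assumes "dominated S"
  obtains l where "l > 1" "\<And>k M. M \<in> words_of_length S k \<Longrightarrow> l ^ k \<le> \<bar>trace M\<bar> + 1"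
proof -
  obtain C l where C: "C > 0" and l: "l > 1" and S: "S \<subseteq> SL2"
    and dom: "\<And>w n. range w \<subseteq> S \<Longrightarrow> onorm ((*v) (word_prod w n)) \<ge> C * l ^ n"
    using assms unfolding dominated_def by blast
  have "l ^ k \<le> \<bar>trace M\<bar> + 1" if M: "M \<in> words_of_length S k" for k M
  proof (rule ccontr)
    let ?g = "\<bar>trace M\<bar> + 1" and ?K = "1 + onorm ((*v) M)"
    assume "\<not> l ^ k \<le> ?g"
    then have "1 < l ^ k / ?g" by (simp add: field_simps)
    then obtain j where j: "?K / C < (l ^ k / ?g) ^ j"
      using real_arch_pow by blast
    have "C * l ^ (k * j) \<le> onorm ((*v) (mat_pow M j))"
      using mat_pow_in_words_of_length[OF M, of j] dom by (auto simp: words_of_length_def)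
    also have "\<dots> \<le> ?K * ?g ^ j"
      by (rule onorm_mat_pow_le) (rule det_words_of_length[OF S M])
    finally have "C * (l ^ k) ^ j \<le> ?K * ?g ^ j" by (simp add: power_mult)
    moreover have "?g ^ j > 0" by simp
    ultimately have "(l ^ k / ?g) ^ j \<le> ?K / C"
      using C by (simp add: power_divide divide_simps mult.commute)
    with j show False by simp
  qed
  with l that show thesis by blast
qed

text \<open>
  The relation \<open>tr (M\<^sup>2) = (tr M)\<^sup>2 - 2\<close> maps \<open>[-2, 2]\<close> to itself. A word with trace in this interval
  therefore yields arbitrarily long words with trace in it, against the exponential growth.
\<close>

lemma dominated_words_hyperbolic:
  assumes dom: "dominated S" and M: "M \<in> words_of_length S k" and k: "k \<ge> 1"
  shows "\<bar>trace M\<bar> > 2"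
proof (rule ccontr)
  assume M2: "\<not> \<bar>trace M\<bar> > 2"
  obtain l where l: "l > 1" "\<And>k M. M \<in> words_of_length S k \<Longrightarrow> l ^ k \<le> \<bar>trace M\<bar> + 1"
    using dominated_trace_growth[OF dom] by blast
  have S: "S \<subseteq> SL2" using dom by (simp add: dominated_def)
  have "\<exists>N. N \<in> words_of_length S (k * 2 ^ i) \<and> \<bar>trace N\<bar> \<le> 2" for i
  proof (induction i)
    case 0
    then show ?case using M M2 by auto
  next
    case (Suc i)
    then obtain N where N: "N \<in> words_of_length S (k * 2 ^ i)" "\<bar>trace N\<bar> \<le> 2" by blast
    have "(trace N)\<^sup>2 \<le> 4" using N(2) abs_le_square_iff[of "trace N" 2] by simp
    moreover have "0 \<le> (trace N)\<^sup>2" by simp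
    ultimately have "\<bar>trace (N ** N)\<bar> \<le> 2"
      unfolding trace_square_SL2[OF det_words_of_length[OF S N(1)]] by linarith
    moreover have "N ** N \<in> words_of_length S (k * 2 ^ Suc i)"
      using words_of_length_mult[OF N(1) N(1)] by (simp add: mult_2 distrib_left)
    ultimately show ?case by blast
  qed
  then have bounded: "l ^ (k * 2 ^ i) \<le> 3" for i
    using l(2)[of _ "k * 2 ^ i"] by (smt (verit))
  obtain n where n: "3 < l ^ n" using real_arch_pow[OF l(1)] by blast
  have "n \<le> k * 2 ^ n"
    using k less_exp[of n] by (metis less_imp_le_nat mult_le_mono nat_mult_1)
  then have "l ^ n \<le> l ^ (k * 2 ^ n)" using l(1) by (intro power_increasing) auto
  with bounded[of n] n show False by simp
qed

section \<open>Eigenvectors of hyperbolic matrices\<close>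

definition wedge :: "real^2 \<Rightarrow> real^2 \<Rightarrow> real" where
  "wedge x y = x$1 * y$2 - x$2 * y$1"

lemma vec2_eq_0_iff: "x = 0 \<longleftrightarrow> x$1 = 0 \<and> x$2 = 0" for x :: "real^2"
  by (simp add: vec_eq_iff forall_2)

lemma rp1_of_eq_iff:
  assumes "x \<noteq> 0" "y \<noteq> 0"
  shows "rp1_of x = rp1_of y \<longleftrightarrow> wedge x y = 0"
  using assms by (auto simp: rp1_of_def wedge_def vec2_eq_0_iff field_simps)

lemma eigenval_SL2_iff:
  assumes "det A = 1"
  shows "eigenval A l \<longleftrightarrow> l\<^sup>2 - trace A * l + 1 = 0"
proof -
  have "eigenval A l \<longleftrightarrow> (\<exists>x. (A - l *\<^sub>R mat 1) *v x = 0 \<and> x \<noteq> 0)"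
    unfolding eigenval_def eigenvec_def
    by (simp add: matrix_vector_mult_diff_rdistrib flip: scaleR_matrix_vector_assoc) blast
  also have "\<dots> \<longleftrightarrow> det (A - l *\<^sub>R mat 1) = 0"
    using invertible_det_nz[of "A - l *\<^sub>R mat 1"]
    unfolding invertible_left_inverse matrix_left_invertible_ker by blast
  also have "det (A - l *\<^sub>R mat 1) = l\<^sup>2 - trace A * l + 1"
    using assms by (simp add: det_2 trace_def sum_2 mat_def algebra_simps power2_eq_square)
  finally show ?thesis .
qed

lemma trace_wedge:
  fixes M :: "real^2^2"
  shows "trace M * wedge x y = wedge (M *v x) y + wedge x (M *v y)"
  by (simp add: wedge_def trace_def sum_2 matrix_vector_mult_def algebra_simps)

lemma hyperbolic_eigen_data:
  assumes "hyperbolic A"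
  obtains a u s where
    "\<bar>a\<bar> > 1" "trace A = a + 1 / a"
    "A *v u = a *\<^sub>R u" "A *v s = (1 / a) *\<^sub>R s" "wedge u s \<noteq> 0"
    "u \<noteq> 0" "s \<noteq> 0" "eig_u A = rp1_of u" "eig_s A = rp1_of s"
proof -
  define T where "T = trace A"
  have det: "det A = 1" and T: "\<bar>T\<bar> > 2"
    using assms by (auto simp: hyperbolic_def SL2_def T_def)
  have "T\<^sup>2 > 4" using T power_strict_mono[of 2 "\<bar>T\<bar>" 2] by simp
  define r where "r = sqrt (T\<^sup>2 - 4)"
  have r: "r > 0" "r\<^sup>2 = T\<^sup>2 - 4" using \<open>T\<^sup>2 > 4\<close> by (auto simp: r_def)
  \<comment> \<open>Of the two roots of the characteristic polynomial, the one with the sign of \<open>T\<close> expands.\<close>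
  define a where "a = (T + sgn T * r) / 2"
  have "sgn T * sgn T = 1" using T by (auto simp: sgn_if)
  have a_eq: "a\<^sup>2 - T * a + 1 = 0"
    using r(2) \<open>sgn T * sgn T = 1\<close> by (simp add: a_def power2_eq_square field_simps)
  have a: "\<bar>a\<bar> > 1" using T r(1) by (auto simp: a_def sgn_if)
  then have "a \<noteq> 0" by auto
  have tr: "trace A = a + 1 / a"
    using a_eq \<open>a \<noteq> 0\<close> by (simp add: T_def field_simps power2_eq_square)
  have ev: "eigenval A l \<longleftrightarrow> l = a \<or> l = 1 / a" for l
  proof -
    have "a * (l\<^sup>2 - trace A * l + 1) = (l - a) * (a * l - 1)"
      using \<open>a \<noteq> 0\<close> by (simp add: tr field_simps power2_eq_square)
    then have "l\<^sup>2 - trace A * l + 1 = 0 \<longleftrightarrow> l - a = 0 \<or> a * l - 1 = 0"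
      using \<open>a \<noteq> 0\<close> by (metis mult_eq_0_iff)
    then show ?thesis
      unfolding eigenval_SL2_iff[OF det] using \<open>a \<noteq> 0\<close> by (simp add: field_simps)
  qed
  have inv: "\<bar>1 / a\<bar> < \<bar>a\<bar>"
  proof -
    have "1 / \<bar>a\<bar> < 1" using a by (simp add: divide_less_eq)
    also note a
    finally show ?thesis by (simp add: abs_divide)
  qed
  have lu: "lambda_u A = a"
    unfolding lambda_u_def using ev inv by (intro the_equality) (auto simp: less_asym)
  have ls: "lambda_s A = 1 / a"
    unfolding lambda_s_def using ev inv by (intro the_equality) (auto simp: less_asym)
  obtain u where u: "u \<noteq> 0" "A *v u = a *\<^sub>R u"
    using ev[of a] by (auto simp: eigenval_def eigenvec_def)
  obtain s where s: "s \<noteq> 0" "A *v s = (1 / a) *\<^sub>R s"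
    using ev[of "1 / a"] by (auto simp: eigenval_def eigenvec_def)
  have ne: "a \<noteq> 1 / a" using inv by auto
  \<comment> \<open>Eigenspaces are lines: two independent eigenvectors for \<open>l\<close> would give trace \<open>2 l\<close>.\<close>
  have same: "rp1_of v = rp1_of v'"
    if "eigenvec A l v" "eigenvec A l v'" "l = a \<or> l = 1 / a" for l v v'
  proof -
    have "(trace A - 2 * l) * wedge v v' = 0"
      using trace_wedge[of A v v'] that(1,2)
      by (simp add: eigenvec_def wedge_def algebra_simps)
    moreover have "trace A - 2 * l \<noteq> 0" using that(3) ne tr by auto
    ultimately show ?thesis
      using rp1_of_eq_iff that(1,2) by (auto simp: eigenvec_def)
  qed
  have eig: "eigenvec A a u" "eigenvec A (1 / a) s"
    using u s by (auto simp: eigenvec_def)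
  have eu: "eig_u A = rp1_of u" unfolding eig_u_def lu
    using eig(1) same by (intro the_equality) blast+
  have es: "eig_s A = rp1_of s" unfolding eig_s_def ls
    using eig(2) same by (intro the_equality) blast+
  have "wedge u s \<noteq> 0"
  proof
    \<comment> \<open>Parallel \<open>u\<close> and \<open>s\<close> would share the eigenvalue, but \<open>a \<noteq> 1 / a\<close>.\<close>
    assume 0: "wedge u s = 0"
    have "(a - 1 / a) * (u$i * s$j) = 0" if "i = 1 \<or> i = 2" "j = 1 \<or> j = 2" for i j
    proof -
      have "A$i$1 * u$1 + A$i$2 * u$2 = a * u$i" "A$i$1 * s$1 + A$i$2 * s$2 = (1 / a) * s$i"
        using u(2) s(2) by (simp_all add: vec_eq_iff matrix_vector_mult_def sum_2)
      moreover have "u$1 * s$j = u$j * s$1" "u$2 * s$j = u$j * s$2" "u$i * s$j = u$j * s$i"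
        using 0 that by (auto simp: wedge_def mult.commute)
      ultimately show ?thesis by algebra
    qed
    then have "u$i * s$j = 0" if "i = 1 \<or> i = 2" "j = 1 \<or> j = 2" for i j
      using that ne by (metis eq_iff_diff_eq_0 mult_eq_0_iff)
    then show False using u(1) s(1) unfolding vec2_eq_0_iff by (metis mult_eq_0_iff)
  qed
  with that a tr u s eu es show thesis by blast
qed

lemma mat_pow_eigenvector:
  fixes x :: "real^2"
  assumes "A *v x = c *\<^sub>R x"
  shows "mat_pow A n *v x = (c ^ n) *\<^sub>R x"
proof (induction n)
  case (Suc n)
  have "mat_pow A (Suc n) *v x = A *v (mat_pow A n *v x)"
    by (simp add: matrix_vector_mul_assoc)
  also have "\<dots> = (c ^ Suc n) *\<^sub>R x"
    by (simp add: Suc assms matrix_vector_mult_scaleR mult.commute)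
  finally show ?case .
qed simp

section \<open>The trace of a product and the cross-ratio\<close>

text \<open>
  Each matrix is the combination of its two spectral projections, and such a projection is a rank
  one matrix whose entries are, up to the factor \<open>wedge u s\<close>, products of the coordinates of \<open>u\<close> and
  \<open>s\<close>. The trace of a product of two rank one matrices is a product of brackets.
\<close>

lemma trace_mult_eigenbases:
  fixes M N :: "real^2^2"
  assumes "M *v u = x *\<^sub>R u" "M *v s = x' *\<^sub>R s" "N *v v = y *\<^sub>R v" "N *v r = y' *\<^sub>R r"
  shows "trace (M ** N) * (wedge u s * wedge v r) =
    (x * y' + x' * y) * (wedge u v * wedge s r) - (x * y + x' * y') * (wedge u r * wedge s v)"
proof -
  have spectral: "wedge u s * L$i$1 = x * u$i * s$2 - x' * s$i * u$2 \<and>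
      wedge u s * L$i$2 = x' * s$i * u$1 - x * u$i * s$1"
    if "L *v u = x *\<^sub>R u" "L *v s = x' *\<^sub>R s" for L :: "real^2^2" and u s x x' i
  proof -
    have "L$i$1 * u$1 + L$i$2 * u$2 = x * u$i" "L$i$1 * s$1 + L$i$2 * s$2 = x' * s$i"
      using that by (auto simp: vec_eq_iff matrix_vector_mult_def sum_2)
    then show ?thesis unfolding wedge_def by algebra
  qed
  have "trace (M ** N) * (wedge u s * wedge v r) =
     (wedge u s * M$1$1) * (wedge v r * N$1$1) + (wedge u s * M$1$2) * (wedge v r * N$2$1) +
     (wedge u s * M$2$1) * (wedge v r * N$1$2) + (wedge u s * M$2$2) * (wedge v r * N$2$2)"
    by (simp add: trace_def sum_2 matrix_matrix_mult_def algebra_simps)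
  also have "\<dots> = (x * y' + x' * y) * (wedge u v * wedge s r) - (x * y + x' * y') * (wedge u r * wedge s v)"
    unfolding spectral[OF assms(1,2), THEN conjunct1] spectral[OF assms(1,2), THEN conjunct2]
      spectral[OF assms(3,4), THEN conjunct1] spectral[OF assms(3,4), THEN conjunct2]
    unfolding wedge_def by algebra
  finally show ?thesis .
qed

lemma wedge_Pluecker: "wedge u v * wedge s r = wedge u s * wedge v r + wedge u r * wedge s v"
  unfolding wedge_def by algebra

text \<open>
  In homogeneous coordinates a difference of points is a bracket up to a factor for each vector.
  Omitting the differences at infinity amounts to normalising by the first coordinate there; the
  sign for the second argument comes from \<open>wedge (x, y) (z, 0) = - y z\<close>.
\<close>

lemma rp1_diff_wedge:
  assumes "rp1_of x \<noteq> rp1_of y"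
  shows "wedge x y = rp1_diff (rp1_of x) (rp1_of y) *
    ((if x$2 = 0 then x$1 else x$2) * (if y$2 = 0 then - y$1 else y$2))"
  using assms by (auto simp: wedge_def rp1_of_def field_simps)

text \<open>
  Every eigenvector occurs once above and once below the fraction bar, and always on the same side
  of the difference, so the factors of \<open>rp1_diff_wedge\<close> cancel.
\<close>

lemma cross_ratio_wedge:
  assumes "eig_u A = rp1_of u" "eig_s A = rp1_of s" "eig_u B = rp1_of v" "eig_s B = rp1_of r"
    and nz: "u \<noteq> 0" "s \<noteq> 0" "v \<noteq> 0" "r \<noteq> 0" and "wedge u r \<noteq> 0" "wedge s v \<noteq> 0"
  shows "cross_ratio A B = (wedge u v * wedge s r) / (wedge u r * wedge s v)"
proof (cases "rp1_of u = rp1_of v \<or> rp1_of s = rp1_of r")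
  case True
  then show ?thesis using assms by (auto simp: cross_ratio_def rp1_of_eq_iff)
next
  case False
  define h where "h x = (if x$2 = 0 then x$1 else x$2)" for x :: "real^2"
  define k where "k y = (if y$2 = 0 then - y$1 else y$2)" for y :: "real^2"
  have hk: "h x \<noteq> 0" "k x \<noteq> 0" if "x \<noteq> 0" for x
    using that by (auto simp: h_def k_def vec2_eq_0_iff)
  have w: "wedge x y = rp1_diff (rp1_of x) (rp1_of y) * (h x * k y)" if "rp1_of x \<noteq> rp1_of y" for x y
    using rp1_diff_wedge[OF that] by (simp add: h_def k_def)
  have "rp1_of u \<noteq> rp1_of r" "rp1_of s \<noteq> rp1_of v"
    using assms by (auto simp: rp1_of_eq_iff)
  with False hk nz show ?thesis
    by (simp add: cross_ratio_def assms(1-4) w)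
qed

section \<open>Powers that balance each other\<close>

lemma ex_max_power_le:
  fixes a x :: real
  assumes "a > 1" "x \<ge> 1"
  obtains m where "a ^ m \<le> x" "x < a ^ m * a"
proof -
  obtain n where n: "x < a ^ n" using real_arch_pow[OF assms(1)] by blast
  define k where "k = (LEAST n. x < a ^ n)"
  have k: "x < a ^ k" unfolding k_def using n by (rule LeastI)
  obtain m where m: "k = Suc m" using k assms(2) by (cases k) auto
  have "\<not> x < a ^ m" using not_less_Least[of m "\<lambda>n. x < a ^ n"] by (simp flip: k_def add: m)
  then have "a ^ m \<le> x" by simp
  moreover have "x < a ^ m * a" using k by (simp add: m mult.commute)
  ultimately show thesis by (rule that)
qed

lemma add_inverse_le_imp_le:
  fixes x L :: real
  assumes "x \<ge> 1" "L > 1" "x + 1 / x \<le> L + 1 / L"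
  shows "x \<le> L"
proof (rule ccontr)
  assume "\<not> x \<le> L"
  have "(x + 1 / x) - (L + 1 / L) = (x - L) * (1 - 1 / (x * L))"
    using assms by (simp add: field_simps)
  moreover have "1 < x * L" using assms by (metis less_1_mult mult.right_neutral mult_1 less_eq_real_def)
  then have "(x - L) * (1 - 1 / (x * L)) > 0"
    using \<open>\<not> x \<le> L\<close> by (intro mult_pos_pos) auto
  ultimately show False using assms(3) by linarith
qed

text \<open>
  The arithmetic core. In the coordinate \<open>p = (x - 1)/(x + 1)\<close>, the value \<open>R\<close> corresponds to
  \<open>p = \<rho>\<close>, the value \<open>L\<close> to \<open>p = \<rho> / (1 + \<rho>\<^sup>2)\<close>, and \<open>R / L\<close> to \<open>p = \<rho>\<^sup>3\<close>. The hypothesis on \<open>a\<close> means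
  \<open>a \<le> L\<close>, so the largest power of \<open>a\<close> not exceeding \<open>R\<close> is larger than \<open>R / L\<close>; likewise for \<open>b\<close>.
\<close>

lemma balanced_powers_give_small_trace:
  fixes a b t :: real
  assumes a: "a > 1" and b: "b > 1" and t: "t > 0"
    and bound: "a + 1 / a \<le> 2 * ((5 + 4 * t) / (3 + 4 * t))" "b + 1 / b \<le> 2 * ((5 + 4 * t) / (3 + 4 * t))"
  obtains m n where "m + n \<ge> (1::nat)"
    "\<bar>(1 + t) * (a ^ m / b ^ n + b ^ n / a ^ m) - t * (a ^ m * b ^ n + 1 / (a ^ m * b ^ n))\<bar> \<le> 2"
proof -
  \<comment> \<open>If \<open>sqrt t = sinh \<theta>\<close> then \<open>\<rho> = exp (- \<theta>)\<close>; rational expressions in \<open>\<rho>\<close> replace the square roots.\<close>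
  define \<rho> where "\<rho> = sqrt (1 + t) - sqrt t"
  have \<rho>0: "\<rho> > 0" using t by (simp add: \<rho>_def)
  have prod1: "\<rho> * (sqrt (1 + t) + sqrt t) = 1"
    using t by (simp add: \<rho>_def algebra_simps flip: power2_eq_square)
  have "sqrt (1 + t) + sqrt t > 1" using t
    by (smt (verit) real_sqrt_gt_0_iff real_sqrt_ge_1_iff)
  with prod1 \<rho>0 have \<rho>1: "\<rho> < 1"
    by (metis mult.commute mult_less_cancel_left_pos mult.right_neutral)
  have inv: "1 / \<rho> = sqrt (1 + t) + sqrt t" using prod1 \<rho>0 by (simp add: field_simps)
  have t4: "4 * t = (1 / \<rho> - \<rho>)\<^sup>2" using t unfolding inv by (simp add: \<rho>_def power2_eq_square)
  define R where "R = (1 + \<rho>) / (1 - \<rho>)"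
  define L where "L = (1 + \<rho> + \<rho>\<^sup>2) / (1 - \<rho> + \<rho>\<^sup>2)"
  have pos: "1 - \<rho> + \<rho>\<^sup>2 > 0" using \<rho>1 by (smt (verit) zero_le_power2)
  have L1: "L > 1" using pos \<rho>0 by (simp add: L_def)
  have R1: "R \<ge> 1" using \<rho>0 \<rho>1 by (simp add: R_def)
  have L_eq: "L + 1 / L = 2 * ((5 + 4 * t) / (3 + 4 * t))"
  proof -
    have q: "(1 + \<rho> + \<rho>\<^sup>2) * (1 - \<rho> + \<rho>\<^sup>2) = 1 + \<rho>\<^sup>2 + \<rho>^4" by algebra
    have num: "(1 + \<rho> + \<rho>\<^sup>2)\<^sup>2 + (1 - \<rho> + \<rho>\<^sup>2)\<^sup>2 = 2 * (1 + 3 * \<rho>\<^sup>2 + \<rho>^4)" by algebra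
    have "1 + \<rho> + \<rho>\<^sup>2 \<noteq> 0" using \<rho>0 by (smt (verit) zero_le_power2)
    moreover have "x / y + 1 / (x / y) = (x\<^sup>2 + y\<^sup>2) / (x * y)" if "x \<noteq> 0" "y \<noteq> 0" for x y :: real
      using that by (simp add: field_simps power2_eq_square)
    ultimately have "L + 1 / L = ((1 + \<rho> + \<rho>\<^sup>2)\<^sup>2 + (1 - \<rho> + \<rho>\<^sup>2)\<^sup>2) / ((1 + \<rho> + \<rho>\<^sup>2) * (1 - \<rho> + \<rho>\<^sup>2))"
      using pos unfolding L_def by (metis less_irrefl)
    also have "\<dots> = 2 * ((1 + 3 * \<rho>\<^sup>2 + \<rho>^4) / (1 + \<rho>\<^sup>2 + \<rho>^4))"
      unfolding num q by simp
    also have "1 + 3 * \<rho>\<^sup>2 + \<rho>^4 = \<rho>\<^sup>2 * (5 + 4 * t)"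
      unfolding t4 using \<rho>0 by (simp add: field_simps power2_eq_square power4_eq_xxxx)
    also have "1 + \<rho>\<^sup>2 + \<rho>^4 = \<rho>\<^sup>2 * (3 + 4 * t)"
      unfolding t4 using \<rho>0 by (simp add: field_simps power2_eq_square power4_eq_xxxx)
    finally show ?thesis using \<rho>0 by simp
  qed
  have ratio: "R = (1 + \<rho>^3) / (1 - \<rho>^3) * L"
  proof -
    have "1 + \<rho>^3 = (1 + \<rho>) * (1 - \<rho> + \<rho>\<^sup>2)" "1 - \<rho>^3 = (1 - \<rho>) * (1 + \<rho> + \<rho>\<^sup>2)" by algebra+
    moreover have "1 + \<rho> + \<rho>\<^sup>2 \<noteq> 0" using \<rho>0 by (smt (verit) zero_le_power2)
    ultimately show ?thesis unfolding R_def L_def using pos \<rho>1 by simp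
  qed
  have \<rho>3: "0 < \<rho>^3" "\<rho>^3 < 1" using \<rho>0 \<rho>1 by (auto simp: power_less_one_iff)
  have ex: "\<exists>m. \<exists>p. \<rho>^3 \<le> p \<and> p \<le> \<rho> \<and> c ^ m = (1 + p) / (1 - p)"
    if c: "c > 1" "c + 1 / c \<le> 2 * ((5 + 4 * t) / (3 + 4 * t))" for c :: real
  proof -
    obtain m where m: "c ^ m \<le> R" "R < c ^ m * c" using ex_max_power_le[OF c(1) R1] .
    have "c \<le> L" using add_inverse_le_imp_le[of c L] c L1 L_eq by simp
    then have "R < c ^ m * L" using m(2) c(1)
      by (smt (verit) mult_left_mono zero_le_power)
    then have lower: "(1 + \<rho>^3) / (1 - \<rho>^3) < c ^ m"
      unfolding ratio using L1 by (metis mult_less_cancel_right_pos less_trans zero_less_one)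
    define p where "p = (c ^ m - 1) / (c ^ m + 1)"
    have x0: "c ^ m > 0" using c by simp
    have "c ^ m = (1 + p) / (1 - p)"
      using x0 by (simp add: p_def field_simps)
    moreover have "p \<le> \<rho>" using m(1) x0 \<rho>1 by (simp add: p_def R_def field_simps)
    moreover have "\<rho>^3 \<le> p" using lower x0 \<rho>3 by (simp add: p_def field_simps)
    ultimately show ?thesis by blast
  qed
  obtain m p where p: "\<rho>^3 \<le> p" "p \<le> \<rho>" "a ^ m = (1 + p) / (1 - p)"
    using ex[OF a bound(1)] by blast
  obtain n q where q: "\<rho>^3 \<le> q" "q \<le> \<rho>" "b ^ n = (1 + q) / (1 - q)"
    using ex[OF b bound(2)] by blast
  have p01: "0 < p" "p < 1" and q01: "0 < q" "q < 1"
    using p(1,2) q(1,2) \<rho>3(1) \<rho>1 by linarith+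
  \<comment> \<open>The window excludes \<open>p = 0\<close>, so the word is not empty.\<close>
  have "a ^ m \<noteq> 1" using p(3) p01 by simp
  then have m1: "m + n \<ge> 1" by (cases m) auto
  have \<rho>_mult: "\<rho>\<^sup>2 * y \<le> x" if "\<rho>^3 \<le> x" "y \<le> \<rho>" for x y
  proof -
    have "\<rho>\<^sup>2 * y \<le> \<rho>\<^sup>2 * \<rho>" using that(2) by (intro mult_left_mono) auto
    also have "\<dots> = \<rho>^3" by (simp add: power2_eq_square power3_eq_cube)
    finally show ?thesis using that(1) by simp
  qed
  \<comment> \<open>The ratio \<open>p / q\<close> lies between the two roots \<open>\<rho>\<^sup>2\<close> and \<open>1 / \<rho>\<^sup>2\<close> of the quadratic form.\<close>
  have up: "(p - q)\<^sup>2 \<le> 4 * t * (p * q)"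
  proof -
    have "\<rho>\<^sup>2 * ((p - q)\<^sup>2 - 4 * t * (p * q)) = - ((q - \<rho>\<^sup>2 * p) * (p - \<rho>\<^sup>2 * q))"
      unfolding t4 using \<rho>0 by (simp add: field_simps power2_eq_square)
    also have "\<dots> \<le> 0"
      using \<rho>_mult[of q p] \<rho>_mult[of p q] p q by simp
    finally show ?thesis using \<rho>0 by (simp add: mult_le_0_iff)
  qed
  \<comment> \<open>Here \<open>p q\<close> is at most the smaller root \<open>\<rho>\<^sup>2\<close> of a quadratic polynomial with roots \<open>\<rho>\<^sup>2\<close>, \<open>1 / \<rho>\<^sup>2\<close>.\<close>
  have lo: "4 * t * (p * q) \<le> (1 - p * q)\<^sup>2"
  proof -
    have pq: "p * q \<le> \<rho>\<^sup>2" unfolding power2_eq_square using p q p01 q01 by (intro mult_mono) auto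
    have "\<rho>\<^sup>2 * (p * q) \<le> 1 * 1"
      using \<rho>0 \<rho>1 p01 q01 by (intro mult_mono) (auto simp: power_le_one mult_le_one)
    with pq have "0 \<le> (\<rho>\<^sup>2 - p * q) * (1 - \<rho>\<^sup>2 * (p * q))" by simp
    also have "\<dots> = \<rho>\<^sup>2 * ((1 - p * q)\<^sup>2 - 4 * t * (p * q))"
      unfolding t4 using \<rho>0 by (simp add: field_simps power2_eq_square)
    finally show ?thesis using \<rho>0 by (simp add: zero_le_mult_iff)
  qed
  let ?x = "a ^ m" and ?y = "b ^ n"
  let ?T = "(1 + t) * (?x / ?y + ?y / ?x) - t * (?x * ?y + 1 / (?x * ?y))"
  define d where "d = (1 - p) * (1 + p) * ((1 - q) * (1 + q))"
  have d: "d > 0" using p01 q01 by (simp add: d_def)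
  have T2: "d * (2 - ?T) = 4 * (4 * t * (p * q) - (p - q)\<^sup>2)"
    and T3: "d * (2 + ?T) = 4 * ((1 - p * q)\<^sup>2 - 4 * t * (p * q))"
  proof -
    have e: "d * (?x / ?y) = (1 + p)\<^sup>2 * (1 - q)\<^sup>2" "d * (?y / ?x) = (1 - p)\<^sup>2 * (1 + q)\<^sup>2"
      "d * (?x * ?y) = (1 + p)\<^sup>2 * (1 + q)\<^sup>2" "d * (1 / (?x * ?y)) = (1 - p)\<^sup>2 * (1 - q)\<^sup>2"
      using p01 q01 by (simp_all add: p(3) q(3) d_def power2_eq_square)
    have "d * ?T = (1 + t) * (d * (?x / ?y) + d * (?y / ?x)) - t * (d * (?x * ?y) + d * (1 / (?x * ?y)))"
      by (simp only: algebra_simps)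
    also have "\<dots> = (1 + t) * ((1 + p)\<^sup>2 * (1 - q)\<^sup>2 + (1 - p)\<^sup>2 * (1 + q)\<^sup>2)
        - t * ((1 + p)\<^sup>2 * (1 + q)\<^sup>2 + (1 - p)\<^sup>2 * (1 - q)\<^sup>2)"
      unfolding e ..
    finally have dT: "d * ?T = \<dots>" .
    show "d * (2 - ?T) = 4 * (4 * t * (p * q) - (p - q)\<^sup>2)"
      unfolding right_diff_distrib[of d 2 ?T] dT unfolding d_def by algebra
    show "d * (2 + ?T) = 4 * ((1 - p * q)\<^sup>2 - 4 * t * (p * q))"
      unfolding distrib_left[of d 2 ?T] dT unfolding d_def by algebra
  qed
  have "0 \<le> d * (2 - ?T)" "0 \<le> d * (2 + ?T)" unfolding T2 T3
    by (rule mult_nonneg_nonneg; simp only: diff_ge_0_iff_ge up lo zero_le_numeral)+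
  then have "\<bar>?T\<bar> \<le> 2" using d by (simp add: zero_le_mult_iff abs_le_iff)
  with m1 that show thesis by blast
qed

section \<open>The trace bound for dominated pairs\<close>

theorem corollary1p4:
  fixes A B :: "real^2^2"
  assumes "A \<in> SL2" and "B \<in> SL2" and "dominated {A, B}"
  shows "cross_ratio_well_defined A B \<and>
    (cross_ratio A B < 1 \<or>
     max (1/2 * \<bar>trace A\<bar>) (1/2 * \<bar>trace B\<bar>) >
       (5 * cross_ratio A B - 1) / (3 * cross_ratio A B + 1))"
proof -
  let ?W = "words_of_length {A, B}"
  have "hyperbolic X" if "X \<in> {A, B}" for X
  proof -
    have tr: "\<bar>trace X\<bar> > 2"
      using dominated_words_hyperbolic[OF assms(3) letter_in_words_of_length[OF that]] by simp
    then have "X \<noteq> mat 1" by (auto simp: trace_def mat_def sum_2)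
    with tr assms(1,2) that show ?thesis by (auto simp: hyperbolic_def)
  qed
  then have hyp: "hyperbolic A" "hyperbolic B" by auto
  obtain a u s where a: "\<bar>a\<bar> > 1" "trace A = a + 1 / a"
    and us: "A *v u = a *\<^sub>R u" "A *v s = (1 / a) *\<^sub>R s" "wedge u s \<noteq> 0" "u \<noteq> 0" "s \<noteq> 0"
    and eA: "eig_u A = rp1_of u" "eig_s A = rp1_of s"
    using hyperbolic_eigen_data[OF hyp(1)] by blast
  obtain b v r where b: "\<bar>b\<bar> > 1" "trace B = b + 1 / b"
    and vr: "B *v v = b *\<^sub>R v" "B *v r = (1 / b) *\<^sub>R r" "wedge v r \<noteq> 0" "v \<noteq> 0" "r \<noteq> 0"
    and eB: "eig_u B = rp1_of v" "eig_s B = rp1_of r"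
    using hyperbolic_eigen_data[OF hyp(2)] by blast
  have nz: "a \<noteq> 0" "b \<noteq> 0" using a b by auto
  define D where "D = wedge u s * wedge v r"
  define X where "X = wedge u r * wedge s v"
  define t where "t = X / D"
  have D: "D \<noteq> 0" using us vr by (simp add: D_def)
  let ?P = "\<lambda>m n. mat_pow A m ** mat_pow B n"
  have P_word: "?P m n \<in> ?W (m + n)" for m n
    using words_of_length_mult[OF mat_pow_in_words_of_length mat_pow_in_words_of_length,
        OF letter_in_words_of_length letter_in_words_of_length, of A "{A, B}" B m n]
    by (simp add: add.commute)
  \<comment> \<open>Negative eigenvalues only change the sign of the trace, so absolute values may be used.\<close>
  have P_trace: "\<bar>trace (?P m n)\<bar> = \<bar>(1 + t) * (\<bar>a\<bar> ^ m / \<bar>b\<bar> ^ n + \<bar>b\<bar> ^ n / \<bar>a\<bar> ^ m)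
      - t * (\<bar>a\<bar> ^ m * \<bar>b\<bar> ^ n + 1 / (\<bar>a\<bar> ^ m * \<bar>b\<bar> ^ n))\<bar>" for m n
  proof -
    define x y where "x = a ^ m" and "y = b ^ n"
    have xy: "x \<noteq> 0" "y \<noteq> 0" using nz by (auto simp: x_def y_def)
    have "trace (?P m n) * D = (x * (1 / y) + (1 / x) * y) * (D + X) - (x * y + (1 / x) * (1 / y)) * X"
      using trace_mult_eigenbases[OF us(1,2)[THEN mat_pow_eigenvector] vr(1,2)[THEN mat_pow_eigenvector], of m n]
      unfolding wedge_Pluecker[of u v s r]
      by (simp add: D_def X_def x_def y_def power_one_over)
    also have "X = t * D" using D by (simp add: t_def)
    finally have "trace (?P m n) * D = ((1 + t) * (x / y + y / x) - t * (x * y + 1 / (x * y))) * D"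
      by (simp add: algebra_simps add_divide_distrib)
    then have "trace (?P m n) = (1 + t) * (x / y + y / x) - t * (x * y + 1 / (x * y))"
      using D by simp
    moreover have "x / y + y / x = sgn (x * y) * (\<bar>x\<bar> / \<bar>y\<bar> + \<bar>y\<bar> / \<bar>x\<bar>)"
      "x * y + 1 / (x * y) = sgn (x * y) * (\<bar>x\<bar> * \<bar>y\<bar> + 1 / (\<bar>x\<bar> * \<bar>y\<bar>))"
      using xy by (auto simp: sgn_if abs_if mult_less_0_iff zero_less_mult_iff field_simps)
    ultimately have "trace (?P m n) = sgn (x * y) *
        ((1 + t) * (\<bar>x\<bar> / \<bar>y\<bar> + \<bar>y\<bar> / \<bar>x\<bar>) - t * (\<bar>x\<bar> * \<bar>y\<bar> + 1 / (\<bar>x\<bar> * \<bar>y\<bar>)))"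
      by (simp add: algebra_simps)
    then show ?thesis using xy by (simp add: abs_mult abs_sgn_eq x_def y_def power_abs)
  qed
  \<comment> \<open>\<open>X = 0\<close> says that an expanding direction of one matrix is a contracting one of the other.\<close>
  have X: "X \<noteq> 0"
  proof
    assume "X = 0"
    then have t0: "t = 0" by (simp add: t_def)
    obtain l where l: "l > 1" "\<And>k M. M \<in> ?W k \<Longrightarrow> l ^ k \<le> \<bar>trace M\<bar> + 1"
      using dominated_trace_growth[OF assms(3)] by blast
    \<comment> \<open>A long power of \<open>B\<close>, compensated by the power of \<open>A\<close> closest to it from below.\<close>
    obtain n where n: "\<bar>a\<bar> + 2 < l ^ n" using real_arch_pow[OF l(1)] by blast
    obtain m where m: "\<bar>a\<bar> ^ m \<le> \<bar>b\<bar> ^ n" "\<bar>b\<bar> ^ n < \<bar>a\<bar> ^ m * \<bar>a\<bar>"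
      using ex_max_power_le[OF a(1), of "\<bar>b\<bar> ^ n"] b(1) by auto
    have pos: "\<bar>a\<bar> ^ m > 0" "\<bar>b\<bar> ^ n > 0" using nz by auto
    have "\<bar>a\<bar> ^ m / \<bar>b\<bar> ^ n \<le> 1" "\<bar>b\<bar> ^ n / \<bar>a\<bar> ^ m \<le> \<bar>a\<bar>"
      using m pos by (auto simp: divide_le_eq mult.commute)
    moreover have "0 \<le> \<bar>a\<bar> ^ m / \<bar>b\<bar> ^ n + \<bar>b\<bar> ^ n / \<bar>a\<bar> ^ m" using pos by simp
    ultimately have "\<bar>trace (?P m n)\<bar> \<le> 1 + \<bar>a\<bar>" unfolding P_trace t0 by simp
    then have "l ^ (m + n) \<le> \<bar>a\<bar> + 2" using l(2)[OF P_word, of m n] by simp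
    moreover have "l ^ n \<le> l ^ (m + n)" using l(1) by (intro power_increasing) auto
    ultimately show False using n by simp
  qed
  then have w: "wedge u r \<noteq> 0" "wedge s v \<noteq> 0" by (auto simp: X_def)
  then have "cross_ratio_well_defined A B"
    unfolding cross_ratio_well_defined_def eA eB using hyp us vr rp1_of_eq_iff by metis
  moreover have "cross_ratio A B < 1 \<or> max (1/2 * \<bar>trace A\<bar>) (1/2 * \<bar>trace B\<bar>) >
       (5 * cross_ratio A B - 1) / (3 * cross_ratio A B + 1)"
  proof (rule ccontr)
    assume "\<not> ?thesis"
    then have C1: "cross_ratio A B \<ge> 1"
      and small: "1/2 * \<bar>trace A\<bar> \<le> (5 * cross_ratio A B - 1) / (3 * cross_ratio A B + 1)"
        "1/2 * \<bar>trace B\<bar> \<le> (5 * cross_ratio A B - 1) / (3 * cross_ratio A B + 1)"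
      by (simp_all add: not_less)
    have "cross_ratio A B = (D + X) / X"
      using cross_ratio_wedge[OF eA eB us(4,5) vr(4,5) w] wedge_Pluecker[of u v s r]
      by (simp add: D_def X_def)
    then have C: "cross_ratio A B = 1 + 1 / t"
      using D X by (simp add: t_def add_divide_distrib)
    have "t \<noteq> 0" using D X by (simp add: t_def)
    with C C1 have t: "t > 0" by (simp add: less_le)
    have K: "(5 * cross_ratio A B - 1) / (3 * cross_ratio A B + 1) = (5 + 4 * t) / (3 + 4 * t)"
    proof -
      have "(5 * (1 + 1 / t) - 1) / (3 * (1 + 1 / t) + 1) =
          (t * (5 * (1 + 1 / t) - 1)) / (t * (3 * (1 + 1 / t) + 1))" using t by simp
      also have "\<dots> = (5 + 4 * t) / (3 + 4 * t)" using t by (simp add: algebra_simps)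
      finally show ?thesis unfolding C .
    qed
    have abs_tr: "\<bar>c + 1 / c\<bar> = \<bar>c\<bar> + 1 / \<bar>c\<bar>" for c :: real
    proof -
      have "\<bar>1 / c\<bar> = 1 / \<bar>c\<bar>" "0 \<le> c \<Longrightarrow> 0 \<le> 1 / c" "c < 0 \<Longrightarrow> 1 / c < 0" by simp_all
      then show ?thesis by linarith
    qed
    have bounds: "\<bar>a\<bar> + 1 / \<bar>a\<bar> \<le> 2 * ((5 + 4 * t) / (3 + 4 * t))"
      "\<bar>b\<bar> + 1 / \<bar>b\<bar> \<le> 2 * ((5 + 4 * t) / (3 + 4 * t))"
    proof -
      have half: "1/2 * x \<le> y \<Longrightarrow> x \<le> 2 * y" for x y :: real by simp
      show "\<bar>a\<bar> + 1 / \<bar>a\<bar> \<le> 2 * ((5 + 4 * t) / (3 + 4 * t))"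
        "\<bar>b\<bar> + 1 / \<bar>b\<bar> \<le> 2 * ((5 + 4 * t) / (3 + 4 * t))"
        using small[unfolded K a(2) b(2) abs_tr, THEN half] by - assumption+
    qed
    obtain m n where mn: "m + n \<ge> (1::nat)" and "\<bar>trace (?P m n)\<bar> \<le> 2"
      using balanced_powers_give_small_trace[OF a(1) b(1) t bounds] unfolding P_trace by blast
    with dominated_words_hyperbolic[OF assms(3) P_word mn] show False by simp
  qed
  ultimately show ?thesis by blast
qed

end
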